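(* Let $P=\{p_1,\ldots,p_m\}$ be a finite poset and $r\ge 1$ an integer. Then the $S$-algebra $A(\Delta_r(P))$ is standard graded.
   Context: Let $K$ be a field, $V=\{(i,j): 1\le i\le r,\ 1\le j\le m\}$ and $S=K[x_{ij}: (i,j)\in V]$. $\Delta_r(P)$ is the simplicial complex on the vertex set $V$ whose facets are exactly the sets $\{(1,j_1),(2,j_2),\ldots,(r,j_r)\}$ with $p_{j_1}\le p_{j_2}\le\cdots\le p_{j_r}$ in $P$ (equivalently, the facet ideal of $\Delta_r(P)$ is generated by the monomials $x_{1j_1}x_{2j_2}\cdots x_{rj_r}$ with $p_{j_1}\le\cdots\le p_{j_r}$). For a simplicial complex $\Delta$ on a finite vertex set $V$ and $k\ge 0$, a $k$-cover of $\Delta$ is a nonzero vector $c\in\mathbb{Z}_{\ge 0}^V$ with $\sum_{v\in F}c_v\ge k$ for every facet $F$ of $\Delta$. For $k\ge 1$, $J_k(\Delta)\subseteq S$ is the ideal spanned over $K$ by the monomials $x^c=\prod_v x_v^{c_v}$ with $c$ a $k$-cover, and $J_0(\Delta)=S$. The vertex cover algebra is $A(\Delta)=\bigoplus_{k\ge 0}J_k(\Delta)t^k\subseteq S[t]$, graded by the degree in $t$ (so $S$ is in degree $0$). It is standard graded if it is generated as an $S$-algebra by its elements of degree $1$. *)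

theory Defs
  imports "HOL-Library.Poly_Mapping" "HOL-Computational_Algebra.Polynomial"
begin

text \<open>An abstract simplicial complex is a family of finite sets (its faces) closed under subsets.\<close>

definition facets :: "'v set set \<Rightarrow> 'v set set" where
  "facets \<Delta> = {F \<in> \<Delta>. \<forall>G\<in>\<Delta>. F \<subseteq> G \<longrightarrow> G = F}"

text \<open>Vectors in \<open>\<int>\<^sub>\<ge>\<^sub>0\<^sup>V\<close> are finitely supported functions whose support lies in the finite set \<open>V\<close>;
  they serve both as covers and as exponents of monomials.\<close>

definition k_cover :: "'v set \<Rightarrow> 'v set set \<Rightarrow> nat \<Rightarrow> ('v \<Rightarrow>\<^sub>0 nat) \<Rightarrow> bool" where
  "k_cover V \<Delta> k c \<longleftrightarrow>
     c \<noteq> 0 \<and> Poly_Mapping.keys c \<subseteq> V \<and>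
     (\<forall>F\<in>facets \<Delta>. (\<Sum>v\<in>F. Poly_Mapping.lookup c v) \<ge> k)"

type_synonym ('v, 'k) mpol = "('v \<Rightarrow>\<^sub>0 nat) \<Rightarrow>\<^sub>0 'k"

text \<open>\<open>S = K[x\<^sub>v : v \<in> V]\<close>, inside the polynomial ring in the variables indexed by the whole type.\<close>

definition pol_ring :: "'v set \<Rightarrow> ('v, 'k::field) mpol set" where
  "pol_ring V = {f. \<forall>a\<in>Poly_Mapping.keys f. Poly_Mapping.keys a \<subseteq> V}"

definition x_pow :: "('v \<Rightarrow>\<^sub>0 nat) \<Rightarrow> ('v, 'k::field) mpol" where
  "x_pow c = Poly_Mapping.single c 1"

definition K_scale :: "'k::field \<Rightarrow> ('v, 'k) mpol \<Rightarrow> ('v, 'k) mpol" where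
  "K_scale a f = Poly_Mapping.single 0 a * f"

lemma vector_space_K_scale: "vector_space (K_scale :: 'k::field \<Rightarrow> ('v, 'k) mpol \<Rightarrow> ('v, 'k) mpol)"
  by unfold_locales
    (simp_all add: K_scale_def algebra_simps single_add mult_single flip: mult.assoc)

definition cover_ideal :: "'v set \<Rightarrow> 'v set set \<Rightarrow> nat \<Rightarrow> ('v, 'k::field) mpol set" where
  "cover_ideal V \<Delta> k =
     (if k = 0 then pol_ring V else module.span K_scale (x_pow ` {c. k_cover V \<Delta> k c}))"

text \<open>The type \<open>('v, 'k) mpol poly\<close> provides the polynomial ring in the extra variable \<open>t\<close>.\<close>

definition vertex_cover_algebra :: "'v set \<Rightarrow> 'v set set \<Rightarrow> ('v, 'k::field) mpol poly set" where
  "vertex_cover_algebra V \<Delta> = {f. \<forall>k. coeff f k \<in> cover_ideal V \<Delta> k}"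

definition homogeneous_part :: "'a::zero poly set \<Rightarrow> nat \<Rightarrow> 'a poly set" where
  "homogeneous_part A k = {f \<in> A. \<exists>a. f = monom a k}"

text \<open>The \<open>S\<close>-subalgebra of the polynomial ring over \<open>S\<close> generated by a set \<open>G\<close>. As \<open>S\<close> will be a
  ring, closure under negation follows from the rules.\<close>

inductive_set generated_algebra :: "'a::comm_ring_1 set \<Rightarrow> 'a poly set \<Rightarrow> 'a poly set"
  for S :: "'a set" and G :: "'a poly set" where
  const: "s \<in> S \<Longrightarrow> [:s:] \<in> generated_algebra S G"
| gen: "g \<in> G \<Longrightarrow> g \<in> generated_algebra S G"
| add: "f \<in> generated_algebra S G \<Longrightarrow> g \<in> generated_algebra S G \<Longrightarrow> f + g \<in> generated_algebra S G"
| mult: "f \<in> generated_algebra S G \<Longrightarrow> g \<in> generated_algebra S G \<Longrightarrow> f * g \<in> generated_algebra S G"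

definition standard_graded :: "'a::comm_ring_1 set \<Rightarrow> 'a poly set \<Rightarrow> bool" where
  "standard_graded S A \<longleftrightarrow> A = generated_algebra S (homogeneous_part A 1)"

definition grid :: "nat \<Rightarrow> nat \<Rightarrow> (nat \<times> nat) set" where
  "grid r m = {1..r} \<times> {1..m}"

text \<open>The sets \<open>{(1,j\<^sub>1),\<dots>,(r,j\<^sub>r)}\<close> with \<open>p\<^bsub>j\<^sub>1\<^esub> \<le> \<dots> \<le> p\<^bsub>j\<^sub>r\<^esub>\<close>; the order is the relation \<open>le\<close>.\<close>

definition multichain_sets ::
  "nat \<Rightarrow> nat \<Rightarrow> (nat \<Rightarrow> 'p) \<Rightarrow> 'p rel \<Rightarrow> (nat \<times> nat) set set" where
  "multichain_sets r m p le =
     {{(i, j i) | i. i \<in> {1..r}} | j.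
        (\<forall>i\<in>{1..r}. j i \<in> {1..m}) \<and> (\<forall>i\<in>{1..<r}. (p (j i), p (j (Suc i))) \<in> le)}"

definition multichain_complex ::
  "nat \<Rightarrow> nat \<Rightarrow> (nat \<Rightarrow> 'p) \<Rightarrow> 'p rel \<Rightarrow> (nat \<times> nat) set set" where
  "multichain_complex r m p le = {F. \<exists>C\<in>multichain_sets r m p le. F \<subseteq> C}"

lemma facets_multichain_complex:
  "facets (multichain_complex r m p le) = multichain_sets r m p le"
proof -
  have eq: "C = D" if C: "C \<in> multichain_sets r m p le" and D: "D \<in> multichain_sets r m p le"
    and sub: "C \<subseteq> D" for C D
  proof -
    obtain j where j: "C = {(i, j i) | i. i \<in> {1..r}}"
      using C unfolding multichain_sets_def by blast
    obtain l where l: "D = {(i, l i) | i. i \<in> {1..r}}"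
      using D unfolding multichain_sets_def by blast
    have "j i = l i" if "i \<in> {1..r}" for i
      using sub that unfolding j l by blast
    then show ?thesis
      unfolding j l by (metis (no_types, lifting))
  qed
  show ?thesis
  proof (intro equalityI subsetI)
    fix F assume "F \<in> facets (multichain_complex r m p le)"
    then show "F \<in> multichain_sets r m p le"
      unfolding facets_def multichain_complex_def by blast
  next
    fix F assume F: "F \<in> multichain_sets r m p le"
    have "G = F" if "G \<in> multichain_complex r m p le" "F \<subseteq> G" for G
    proof -
      obtain C where C: "C \<in> multichain_sets r m p le" "G \<subseteq> C"
        using \<open>G \<in> multichain_complex r m p le\<close> unfolding multichain_complex_def by blast
      have "F = C"
        using eq[OF F C(1)] C(2) \<open>F \<subseteq> G\<close> by blast
      then show "G = F" using C(2) \<open>F \<subseteq> G\<close> by blast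
    qed
    then show "F \<in> facets (multichain_complex r m p le)"
      using F unfolding facets_def multichain_complex_def by blast
  qed
qed

end

theory Submission
  imports Defs
begin

text \<open>
  The degree \<open>k\<close> piece of the vertex cover algebra is spanned over \<open>K\<close> by monomials, so standard
  gradedness is a statement about exponents: it holds as soon as each \<open>(k + 1)\<close>-cover \<open>c\<close>
  is the sum of a \<open>1\<close>-cover and a \<open>k\<close>-cover (any vector, if \<open>k = 0\<close>), because then \<open>x\<^sup>c t\<^sup>k\<^sup>+\<^sup>1\<close> is a product of
  elements of degree one by induction (\<open>standard_graded_if_covers_split\<close>).

  For the multichain complex the splitting comes from the duality between shortest paths and
  cuts. The facets are the paths through a layered digraph with layers \<open>1, \<dots>, r\<close>, whose
  vertices \<open>(i, j)\<close> have lengths \<open>c(i, j)\<close>. Let \<open>e(i, j)\<close> be the least length of a path from the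
  first layer that stops just before \<open>(i, j)\<close>, and put \<open>d(i, j) = e(i, j) + c(i, j)\<close>. Then
  \<open>e\<close> vanishes on the first layer, is bounded at each vertex of a path by the value of \<open>d\<close> at the
  preceding vertex, and \<open>d \<ge> k + 1\<close> on the last layer because \<open>c\<close> is a cover. For every monotone
  \<open>\<phi>\<close> with \<open>\<phi>(0) = 0\<close> the vector \<open>\<phi>(d) - \<phi>(e)\<close> therefore has sum at least \<open>\<phi>(k + 1)\<close> along every
  facet, by telescoping (\<open>layer_chain_sum\<close>). The two functions \<open>min(1, n)\<close> and \<open>max(n - 1, 0)\<close> add
  up to \<open>n\<close>; hence they cut \<open>c = d - e\<close> into a \<open>1\<close>-cover and a vector with sum at least \<open>k\<close> along
  every facet.
\<close>

section \<open>The graded pieces in terms of exponents\<close>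

lemma sum_monomials:
  "f = (\<Sum>a\<in>Poly_Mapping.keys f. Poly_Mapping.single a (Poly_Mapping.lookup f a))"
proof (rule poly_mapping_eqI)
  fix b
  have "(\<Sum>a\<in>Poly_Mapping.keys f. Poly_Mapping.lookup f a when a = b) = Poly_Mapping.lookup f b"
    by (simp add: when_def in_keys_iff)
  then show "Poly_Mapping.lookup f b = Poly_Mapping.lookup
      (\<Sum>a\<in>Poly_Mapping.keys f. Poly_Mapping.single a (Poly_Mapping.lookup f a)) b"
    by (simp add: lookup_sum lookup_single)
qed

text \<open>The exponents of the monomials in the degree \<open>k\<close> piece. Degree \<open>0\<close> is separate because the
  exponent \<open>0\<close>, of the unit monomial, is allowed there although a cover must be nonzero.\<close>

definition admissible :: "'v set \<Rightarrow> 'v set set \<Rightarrow> nat \<Rightarrow> ('v \<Rightarrow>\<^sub>0 nat) \<Rightarrow> bool" where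
  "admissible V \<Delta> k a \<longleftrightarrow> Poly_Mapping.keys a \<subseteq> V \<and> (k = 0 \<or> k_cover V \<Delta> k a)"

lemma admissible_add:
  assumes "admissible V \<Delta> k a" "admissible V \<Delta> l b"
  shows "admissible V \<Delta> (k + l) (a + b)"
proof -
  have keys: "Poly_Mapping.keys (a + b) \<subseteq> V"
    using assms Poly_Mapping.keys_add[of a b] unfolding admissible_def by blast
  have nz: "a + b \<noteq> 0" if "a \<noteq> 0 \<or> b \<noteq> 0"
  proof
    assume "a + b = 0"
    then have "Poly_Mapping.lookup a v = 0 \<and> Poly_Mapping.lookup b v = 0" for v
      by (metis add_is_0 lookup_add lookup_zero)
    then show False using that by (metis lookup_zero poly_mapping_eqI)
  qed
  have sum: "k + l \<le> (\<Sum>v\<in>F. Poly_Mapping.lookup (a + b) v)" if "F \<in> facets \<Delta>" for F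
  proof -
    have "k \<le> (\<Sum>v\<in>F. Poly_Mapping.lookup a v)" "l \<le> (\<Sum>v\<in>F. Poly_Mapping.lookup b v)"
      using assms that by (auto simp: admissible_def k_cover_def)
    then show ?thesis by (simp add: lookup_add sum.distrib)
  qed
  show ?thesis
    using keys nz sum assms by (auto simp: admissible_def k_cover_def)
qed

text \<open>A space spanned by monomials consists of the polynomials all of whose monomials lie in the
  spanning set. This makes membership in the ideals a condition on supports, for which sums and
  products are easy to control.\<close>

lemma cover_ideal_eq_admissible:
  "cover_ideal V \<Delta> k =
     {f :: ('v, 'k::field) mpol. \<forall>a\<in>Poly_Mapping.keys f. admissible V \<Delta> k a}"
proof (cases "k = 0")
  case True
  then show ?thesis by (auto simp: cover_ideal_def pol_ring_def admissible_def)
next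
  case False
  interpret vector_space "K_scale :: 'k \<Rightarrow> ('v, 'k) mpol \<Rightarrow> ('v, 'k) mpol"
    by (rule vector_space_K_scale)
  let ?C = "{c. k_cover V \<Delta> k c}"
  have adm: "admissible V \<Delta> k a \<longleftrightarrow> a \<in> ?C" for a
    using False by (auto simp: admissible_def k_cover_def)
  have "span (x_pow ` ?C) = {f :: ('v, 'k) mpol. Poly_Mapping.keys f \<subseteq> ?C}"
  proof (intro equalityI subsetI)
    fix f :: "('v, 'k) mpol" assume "f \<in> span (x_pow ` ?C)"
    then show "f \<in> {f. Poly_Mapping.keys f \<subseteq> ?C}"
    proof (induction rule: span_induct_alt)
      case base
      then show ?case by simp
    next
      case (step a x g)
      then obtain c where c: "c \<in> ?C" "x = x_pow c" by blast
      have "K_scale a x = Poly_Mapping.single c a"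
        by (simp add: c K_scale_def x_pow_def mult_single)
      then have "Poly_Mapping.keys (K_scale a x + g) \<subseteq> insert c (Poly_Mapping.keys g)"
        using Poly_Mapping.keys_add[of "K_scale a x" g] by (auto split: if_splits)
      then show ?case using step c by blast
    qed
  next
    fix f :: "('v, 'k) mpol" assume f: "f \<in> {f. Poly_Mapping.keys f \<subseteq> ?C}"
    have "f = (\<Sum>a\<in>Poly_Mapping.keys f. Poly_Mapping.single a (Poly_Mapping.lookup f a))"
      by (rule sum_monomials)
    also have "\<dots> = (\<Sum>a\<in>Poly_Mapping.keys f. K_scale (Poly_Mapping.lookup f a) (x_pow a))"
      by (simp add: K_scale_def x_pow_def mult_single)
    also have "\<dots> \<in> span (x_pow ` ?C)"
      using f by (intro span_sum span_scale span_base) auto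
    finally show "f \<in> span (x_pow ` ?C)" .
  qed
  then show ?thesis using False adm by (auto simp: cover_ideal_def)
qed

lemma cover_ideal_zero: "0 \<in> cover_ideal V \<Delta> k"
  by (simp add: cover_ideal_eq_admissible)

lemma cover_ideal_add:
  "f \<in> cover_ideal V \<Delta> k \<Longrightarrow> g \<in> cover_ideal V \<Delta> k \<Longrightarrow> f + g \<in> cover_ideal V \<Delta> k"
  using Poly_Mapping.keys_add[of f g] by (auto simp: cover_ideal_eq_admissible)

lemma cover_ideal_sum:
  "(\<And>i. i \<in> I \<Longrightarrow> f i \<in> cover_ideal V \<Delta> k) \<Longrightarrow> sum f I \<in> cover_ideal V \<Delta> k"
  by (induction I rule: infinite_finite_induct) (auto intro: cover_ideal_zero cover_ideal_add)

lemma cover_ideal_mult: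
  assumes "f \<in> cover_ideal V \<Delta> k" "g \<in> cover_ideal V \<Delta> l"
  shows "f * g \<in> cover_ideal V \<Delta> (k + l)"
  using assms Poly_Mapping.keys_mult[of f g] admissible_add
  unfolding cover_ideal_eq_admissible by blast

lemma generated_subset_vertex_cover_algebra:
  "generated_algebra (pol_ring V) (homogeneous_part (vertex_cover_algebra V \<Delta>) 1)
     \<subseteq> vertex_cover_algebra V \<Delta>"
proof
  fix f assume "f \<in> generated_algebra (pol_ring V) (homogeneous_part (vertex_cover_algebra V \<Delta>) 1)"
  then show "f \<in> vertex_cover_algebra V \<Delta>"
  proof induction
    case (const s)
    then show ?case
      by (auto simp: vertex_cover_algebra_def coeff_pCons cover_ideal_def[of _ _ 0]
          intro: cover_ideal_zero split: nat.split)
  next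
    case (gen g)
    then show ?case by (simp add: homogeneous_part_def)
  next
    case (add f g)
    then show ?case by (simp add: vertex_cover_algebra_def cover_ideal_add)
  next
    case (mult f g)
    have "coeff f i * coeff g (n - i) \<in> cover_ideal V \<Delta> n" if "i \<le> n" for i n
      using cover_ideal_mult[of "coeff f i" V \<Delta> i "coeff g (n - i)" "n - i"] mult.IH that
      by (simp add: vertex_cover_algebra_def)
    then show ?case
      by (auto simp: vertex_cover_algebra_def coeff_mult intro!: cover_ideal_sum)
  qed
qed

section \<open>Reduction to splitting covers\<close>

lemma generated_algebra_sum:
  assumes "0 \<in> S" "\<And>i. i \<in> I \<Longrightarrow> f i \<in> generated_algebra S G"
  shows "sum f I \<in> generated_algebra S G"
proof -
  have "0 \<in> generated_algebra S G"
    using generated_algebra.const[OF assms(1)] by simp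
  then show ?thesis
    using assms(2)
    by (induction I rule: infinite_finite_induct) (auto intro: generated_algebra.add)
qed

text \<open>Peeling off one \<open>1\<close>-cover at a time writes \<open>x\<^sup>c t\<^sup>k\<close> as a product of \<open>k\<close> generators and an
  element of \<open>S\<close>; every element of the algebra is an \<open>S\<close>-linear combination of such monomials.\<close>

lemma standard_graded_if_covers_split:
  assumes split: "\<And>k c. k_cover V \<Delta> (Suc k) c \<Longrightarrow>
      \<exists>a b. c = a + b \<and> k_cover V \<Delta> 1 a \<and> admissible V \<Delta> k b"
  shows "standard_graded (pol_ring V)
      (vertex_cover_algebra V \<Delta> :: ('v, 'k::field) mpol poly set)"
proof -
  let ?A = "vertex_cover_algebra V \<Delta> :: ('v, 'k) mpol poly set"
  let ?B = "generated_algebra (pol_ring V) (homogeneous_part ?A 1)"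
  have zero: "0 \<in> pol_ring V" by (simp add: pol_ring_def)
  have pow: "monom (x_pow c) k \<in> ?B" if "admissible V \<Delta> k c" for k c
    using that
  proof (induction k arbitrary: c)
    case 0
    then have "[:x_pow c:] \<in> ?B"
      by (intro generated_algebra.const) (simp add: admissible_def pol_ring_def x_pow_def)
    then show ?case by (simp add: monom_0)
  next
    case (Suc k)
    then obtain a b where ab: "c = a + b" "k_cover V \<Delta> 1 a" "admissible V \<Delta> k b"
      using split unfolding admissible_def by blast
    have "monom (x_pow a) 1 \<in> ?A"
      using ab(2) by (auto simp: vertex_cover_algebra_def cover_ideal_eq_admissible x_pow_def
          admissible_def k_cover_def)
    then have "monom (x_pow a) 1 \<in> ?B"
      by (auto simp: homogeneous_part_def intro: generated_algebra.gen)
    then have "monom (x_pow a) 1 * monom (x_pow b) k \<in> ?B"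
      using Suc.IH[OF ab(3)] by (rule generated_algebra.mult)
    then show ?case by (simp add: mult_monom x_pow_def mult_single ab(1))
  qed
  have piece: "monom g k \<in> ?B" if g: "g \<in> cover_ideal V \<Delta> k" for g :: "('v, 'k) mpol" and k
  proof -
    have "monom g k =
        monom (\<Sum>a\<in>Poly_Mapping.keys g. Poly_Mapping.single a (Poly_Mapping.lookup g a)) k"
      using sum_monomials[of g] by simp
    also have "\<dots> = (\<Sum>a\<in>Poly_Mapping.keys g.
        [:Poly_Mapping.single 0 (Poly_Mapping.lookup g a):] * monom (x_pow a) k)"
      by (simp add: monom_sum x_pow_def smult_monom mult_single)
    also have "\<dots> \<in> ?B"
    proof (intro generated_algebra_sum zero generated_algebra.mult generated_algebra.const pow)
      fix a assume "a \<in> Poly_Mapping.keys g"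
      then show "admissible V \<Delta> k a" using g by (simp add: cover_ideal_eq_admissible)
    qed (simp add: pol_ring_def)
    finally show ?thesis .
  qed
  have "?A \<subseteq> ?B"
  proof
    fix f assume "f \<in> ?A"
    then have "(\<Sum>i\<le>degree f. monom (coeff f i) i) \<in> ?B"
      by (intro generated_algebra_sum zero piece) (simp add: vertex_cover_algebra_def)
    then show "f \<in> ?B" by (simp add: poly_as_sum_of_monoms)
  qed
  then show ?thesis
    unfolding standard_graded_def using generated_subset_vertex_cover_algebra by blast
qed

section \<open>Lightest multichains\<close>

text \<open>With \<open>D j\<close> the set of elements that may precede \<open>j\<close> in a chain, \<open>min_weight D w i j\<close> is the
  least \<open>w\<close>-weight of a chain through rows \<open>1, \<dots>, i\<close> that may be continued by \<open>j\<close>, the entry \<open>j\<close>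
  itself not being counted. So \<open>min_weight D w (i - 1) j\<close> belongs to the grid point \<open>(i, j)\<close>.\<close>

primrec min_weight :: "('a \<Rightarrow> 'a set) \<Rightarrow> (nat \<times> 'a \<Rightarrow> nat) \<Rightarrow> nat \<Rightarrow> 'a \<Rightarrow> nat" where
  "min_weight D w 0 j = 0"
| "min_weight D w (Suc i) j = Min ((\<lambda>l. min_weight D w i l + w (Suc i, l)) ` D j)"

lemma min_weight_Suc_le:
  assumes "finite (D j)" "l \<in> D j"
  shows "min_weight D w (Suc i) j \<le> min_weight D w i l + w (Suc i, l)"
  using assms by simp

text \<open>The minimum is the weight of an actual chain. This is how the covering condition, which only
  speaks of chains, bounds \<open>min_weight\<close> from below. The hypothesis \<open>j \<in> D j\<close> ensures that all the
  minima are over nonempty sets.\<close>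

lemma min_weight_attained:
  assumes "finite J" "\<And>j. j \<in> J \<Longrightarrow> j \<in> D j \<and> D j \<subseteq> J" "j \<in> J"
  shows "\<exists>s. (\<forall>h\<in>{1..i}. s h \<in> J) \<and> (\<forall>h\<in>{1..<i}. s h \<in> D (s (Suc h))) \<and>
     (i \<noteq> 0 \<longrightarrow> s i \<in> D j) \<and> min_weight D w i j = (\<Sum>h=1..i. w (h, s h))"
  using assms(3)
proof (induction i arbitrary: j)
  case 0
  then show ?case by simp
next
  case (Suc i)
  have "finite (D j)" "D j \<noteq> {}"
    using assms(1,2) Suc.prems by (auto intro: finite_subset)
  then have "min_weight D w (Suc i) j \<in> (\<lambda>l. min_weight D w i l + w (Suc i, l)) ` D j"
    by (simp only: min_weight.simps) (rule Min_in; simp)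
  then obtain l where l: "l \<in> D j" "min_weight D w (Suc i) j = min_weight D w i l + w (Suc i, l)"
    by blast
  then have "l \<in> J" using assms(2) Suc.prems by blast
  then obtain s where s: "\<forall>h\<in>{1..i}. s h \<in> J" "\<forall>h\<in>{1..<i}. s h \<in> D (s (Suc h))"
     "i \<noteq> 0 \<longrightarrow> s i \<in> D l" "min_weight D w i l = (\<Sum>h=1..i. w (h, s h))"
    using Suc.IH by blast
  let ?s = "s(Suc i := l)"
  have "(\<Sum>h=1..Suc i. w (h, ?s h)) = (\<Sum>h=1..i. w (h, s h)) + w (Suc i, l)"
    by simp
  moreover have "?s h \<in> D (?s (Suc h))" if "h \<in> {1..<Suc i}" for h
    using that s(2,3) by (cases "h = i") auto
  moreover have "?s h \<in> J" if "h \<in> {1..Suc i}" for h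
    using that s(1) \<open>l \<in> J\<close> by (cases "h = Suc i") auto
  ultimately show ?case
    using l s(4) by (intro exI[of _ ?s]) auto
qed

text \<open>Over the grid point \<open>v\<close> place the interval of length \<open>w v\<close> that starts at the least weight of a
  chain leading to \<open>v\<close>; \<open>layer D w \<phi> v\<close> is its length measured by \<open>\<phi>\<close>. If \<open>\<phi>\<close> counts the points of
  a set of levels up to a given height, this is the number of those levels that the interval
  meets.\<close>

definition layer ::
  "('a \<Rightarrow> 'a set) \<Rightarrow> (nat \<times> 'a \<Rightarrow> nat) \<Rightarrow> (nat \<Rightarrow> nat) \<Rightarrow> nat \<times> 'a \<Rightarrow> nat" where
  "layer D w \<phi> v =
     \<phi> (min_weight D w (fst v - 1) (snd v) + w v) - \<phi> (min_weight D w (fst v - 1) (snd v))"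

text \<open>Along a chain each interval starts no higher than the preceding one ends, since one way to
  reach the next point is through the current one. The intervals thus cover everything from \<open>0\<close> to
  the end of the last one, and the sum telescopes.\<close>

lemma layer_chain_sum:
  assumes "mono \<phi>" "\<phi> 0 = 0" "\<And>i. i \<in> {1..n} \<Longrightarrow> finite (D (s i))"
    and "\<And>i. i \<in> {1..<n} \<Longrightarrow> s i \<in> D (s (Suc i))" "n \<ge> 1"
  shows "\<phi> (min_weight D w (n - 1) (s n) + w (n, s n)) \<le> (\<Sum>i=1..n. layer D w \<phi> (i, s i))"
  using \<open>n \<ge> 1\<close> assms(3,4)
proof (induction n rule: dec_induct)
  case base
  then show ?case using assms(2) by (simp add: layer_def)
next
  case (step n)
  then obtain n' where n': "n = Suc n'" by (cases n) auto
  have "min_weight D w n (s (Suc n)) \<le> min_weight D w (n - 1) (s n) + w (n, s n)"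
    unfolding n' using step.prems by (simp add: n' del: min_weight.simps) (rule min_weight_Suc_le; simp)
  then have "\<phi> (min_weight D w n (s (Suc n))) \<le> \<phi> (min_weight D w (n - 1) (s n) + w (n, s n))"
    by (rule monoD[OF assms(1)])
  also have "\<dots> \<le> (\<Sum>i=1..n. layer D w \<phi> (i, s i))"
    using step by simp
  finally show ?case by (simp add: layer_def)
qed

section \<open>Splitting covers of the multichain complex\<close>

lemma k_cover_multichain_complex_iff:
  "k_cover V (multichain_complex r m p le) k c \<longleftrightarrow>
     c \<noteq> 0 \<and> Poly_Mapping.keys c \<subseteq> V \<and>
     (\<forall>s. (\<forall>i\<in>{1..r}. s i \<in> {1..m}) \<and> (\<forall>i\<in>{1..<r}. (p (s i), p (s (Suc i))) \<in> le) \<longrightarrow>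
        k \<le> (\<Sum>i=1..r. Poly_Mapping.lookup c (i, s i)))"
proof -
  have sum: "(\<Sum>v\<in>{(i, s i) | i. i \<in> {1..r}}. Poly_Mapping.lookup c v) =
      (\<Sum>i=1..r. Poly_Mapping.lookup c (i, s i))" for s
  proof -
    have "{(i, s i) | i. i \<in> {1..r}} = (\<lambda>i. (i, s i)) ` {1..r}" by blast
    then show ?thesis by (simp add: sum.reindex inj_on_def)
  qed
  show ?thesis
    unfolding k_cover_def facets_multichain_complex multichain_sets_def sum[symmetric] by blast
qed

text \<open>Both summands are layers of the same system of intervals: the \<open>1\<close>-cover records which
  intervals contain the lowest level, the other summand the number of higher levels in each.\<close>

lemma k_cover_multichain_complex_split:
  fixes p :: "nat \<Rightarrow> 'p" and le :: "'p rel"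
  assumes refl: "\<And>j. j \<in> {1..m} \<Longrightarrow> (p j, p j) \<in> le" and r: "r \<ge> 1"
    and c: "k_cover (grid r m) (multichain_complex r m p le) (Suc k) c"
  shows "\<exists>a b. c = a + b \<and> k_cover (grid r m) (multichain_complex r m p le) 1 a \<and>
    admissible (grid r m) (multichain_complex r m p le) k b"
proof -
  define D where "D j = {l \<in> {1..m}. (p l, p j) \<in> le}" for j
  let ?w = "Poly_Mapping.lookup c"
  have finD: "finite (D j)" for j by (simp add: D_def)
  have D: "j \<in> D j \<and> D j \<subseteq> {1..m}" if "j \<in> {1..m}" for j
    using that refl by (auto simp: D_def)
  have c_nz: "c \<noteq> 0" and c_keys: "Poly_Mapping.keys c \<subseteq> grid r m"
    using c by (auto simp: k_cover_multichain_complex_iff)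
  \<comment> \<open>For \<open>m = 0\<close> the grid is empty and carries no nonzero vectors, hence no covers.\<close>
  have m: "1 \<in> {1..m}"
  proof -
    have "Poly_Mapping.keys c \<noteq> {}" using c_nz by simp
    then obtain v where "v \<in> grid r m" using c_keys by blast
    then show ?thesis by (auto simp: grid_def)
  qed
  \<comment> \<open>The value of \<open>min_weight\<close> at \<open>r\<close> and \<open>j\<close> is the weight of a chain through all rows, that is, of
    a facet. By reflexivity \<open>j\<close> itself may be the last entry of a chain that \<open>j\<close> continues.\<close>
  have heavy: "Suc k \<le> min_weight D ?w (r - 1) j + ?w (r, j)" if j: "j \<in> {1..m}" for j
  proof -
    obtain s where s: "\<forall>h\<in>{1..r}. s h \<in> {1..m}" "\<forall>h\<in>{1..<r}. s h \<in> D (s (Suc h))"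
      "min_weight D ?w r j = (\<Sum>h=1..r. ?w (h, s h))"
      using min_weight_attained[of "{1..m}" D j r ?w] D j by blast
    have "\<forall>h\<in>{1..<r}. (p (s h), p (s (Suc h))) \<in> le"
      using s(2) by (simp add: D_def)
    then have "Suc k \<le> (\<Sum>h=1..r. ?w (h, s h))"
      using c s(1) unfolding k_cover_multichain_complex_iff by blast
    also have "\<dots> = min_weight D ?w (Suc (r - 1)) j" using s(3) r by simp
    also have "\<dots> \<le> min_weight D ?w (r - 1) j + ?w (Suc (r - 1), j)"
      by (rule min_weight_Suc_le) (use finD D j in auto)
    finally show ?thesis using r by simp
  qed
  define part where "part \<phi> = Abs_poly_mapping (layer D ?w \<phi>)" for \<phi>
  \<comment> \<open>Where \<open>c\<close> vanishes the interval is empty.\<close>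
  have supp: "{v. layer D ?w \<phi> v \<noteq> 0} \<subseteq> Poly_Mapping.keys c" for \<phi>
    by (auto simp: layer_def in_keys_iff intro!: gr0I)
  have lookup_part: "Poly_Mapping.lookup (part \<phi>) = layer D ?w \<phi>" for \<phi>
    unfolding part_def
    by (rule Abs_poly_mapping_inverse) (use finite_subset[OF supp[of \<phi>] finite_keys] in simp)
  have keys_part: "Poly_Mapping.keys (part \<phi>) \<subseteq> grid r m" for \<phi>
    using supp[of \<phi>] c_keys by (auto simp: in_keys_iff lookup_part)
  have cover_sum: "\<phi> (Suc k) \<le> (\<Sum>i=1..r. Poly_Mapping.lookup (part \<phi>) (i, s i))"
    if "mono \<phi>" "\<phi> 0 = 0" and s: "\<forall>i\<in>{1..r}. s i \<in> {1..m}"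
      "\<forall>i\<in>{1..<r}. (p (s i), p (s (Suc i))) \<in> le" for \<phi> s
  proof -
    have "\<phi> (Suc k) \<le> \<phi> (min_weight D ?w (r - 1) (s r) + ?w (r, s r))"
      by (rule monoD[OF \<open>mono \<phi>\<close>]) (use heavy s(1) r in auto)
    also have "\<dots> \<le> (\<Sum>i=1..r. layer D ?w \<phi> (i, s i))"
      by (rule layer_chain_sum) (use that r finD in \<open>auto simp: D_def\<close>)
    finally show ?thesis by (simp add: lookup_part)
  qed
  have cover: "k_cover (grid r m) (multichain_complex r m p le) (\<phi> (Suc k)) (part \<phi>)"
    if \<phi>: "mono \<phi>" "\<phi> 0 = 0" "\<phi> (Suc k) \<noteq> 0" for \<phi>
  proof -
    \<comment> \<open>The constant chain at \<open>1\<close> is a facet along which the sum is positive.\<close>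
    have "part \<phi> \<noteq> 0"
    proof
      assume "part \<phi> = 0"
      then show False using cover_sum[OF \<phi>(1,2), of "\<lambda>_. 1"] m refl \<phi>(3) by simp
    qed
    then show ?thesis
      unfolding k_cover_multichain_complex_iff using keys_part cover_sum[OF \<phi>(1,2)] by blast
  qed
  let ?\<phi> = "min (1::nat)" and ?\<psi> = "\<lambda>n::nat. n - 1"
  have "mono ?\<phi>" "mono ?\<psi>" by (auto simp: mono_def)
  have "c = part ?\<phi> + part ?\<psi>"
    by (rule poly_mapping_eqI) (auto simp: lookup_add lookup_part layer_def min_def)
  moreover have "k_cover (grid r m) (multichain_complex r m p le) 1 (part ?\<phi>)"
    using cover[OF \<open>mono ?\<phi>\<close>] by simp
  moreover have "admissible (grid r m) (multichain_complex r m p le) k (part ?\<psi>)"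
    using cover[OF \<open>mono ?\<psi>\<close>] keys_part by (auto simp: admissible_def)
  ultimately show ?thesis by blast
qed

theorem theorem1p5:
  fixes P :: "'p set" and le :: "'p rel" and p :: "nat \<Rightarrow> 'p" and m r :: nat
  assumes "partial_order_on P le"
    and "bij_betw p {1..m} P"
    and "r \<ge> 1"
  shows "standard_graded (pol_ring (grid r m))
    (vertex_cover_algebra (grid r m) (multichain_complex r m p le)
      :: (nat \<times> nat, 'k::field) mpol poly set)"
proof (rule standard_graded_if_covers_split)
  have "(p j, p j) \<in> le" if "j \<in> {1..m}" for j
    using that assms(1,2)
    by (auto simp: partial_order_on_def preorder_on_def refl_on_def bij_betw_def)
  then show "\<exists>a b. c = a + b \<and> k_cover (grid r m) (multichain_complex r m p le) 1 a \<and>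
      admissible (grid r m) (multichain_complex r m p le) k b"
    if "k_cover (grid r m) (multichain_complex r m p le) (Suc k) c" for k c
    using k_cover_multichain_complex_split[OF _ \<open>r \<ge> 1\<close> that] by blast
qed

end
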